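(* The sparing number of an odd-conjoined graph is $1$, and the sparing number of an even-conjoined graph is $0$.
   Context: All graphs are simple and finite, with no isolated vertices; $\mathbb{N}_0$ denotes the set of non-negative integers. For $A,B\subseteq\mathbb{N}_0$, $A+B=\{a+b: a\in A, b\in B\}$. An integer additive set-indexer (IASI) of a graph $G$ is an injective function $f:V(G)\to 2^{\mathbb{N}_0}$ such that the induced function $g_f:E(G)\to 2^{\mathbb{N}_0}$, $g_f(uv)=f(u)+f(v)$, is also injective. An IASI $f$ is a weak IASI if $|g_f(uv)|=\max(|f(u)|,|f(v)|)$ for every edge $uv$. An element (vertex or edge) whose set-label has cardinality $1$ is called mono-indexed. The sparing number of $G$ is the minimum number of mono-indexed edges required for $G$ to admit a weak IASI. A conjoined graph is a graph $G=\bigcup_{i=1}^n C_{m_i}$ which is a union of cycles all having the same common edge (or common path). It is odd-conjoined if all these cycles are odd cycles, and even-conjoined if all of them are even cycles.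
   Formalization: Set-labels are required to be finite (with infinite labels a triangle has a weak IASI with no mono-indexed edge), and any two of the cycles are required to meet exactly in the common edge or path (otherwise K4, a union of two 4-cycles through an edge, would be a counterexample). *)

theory Defs
  imports Main "HOL-Library.Set_Algebras"
begin

record 'a ugraph =
  verts :: "'a set"
  edges :: "'a set set"

definition subgraph :: "'a ugraph \<Rightarrow> 'a ugraph \<Rightarrow> bool" where
  "subgraph H G \<longleftrightarrow> verts H \<subseteq> verts G \<and> edges H \<subseteq> edges G"

definition graph_inter :: "'a ugraph \<Rightarrow> 'a ugraph \<Rightarrow> 'a ugraph" where
  "graph_inter G H = \<lparr>verts = verts G \<inter> verts H, edges = edges G \<inter> edges H\<rparr>"

definition graph_Union :: "'i set \<Rightarrow> ('i \<Rightarrow> 'a ugraph) \<Rightarrow> 'a ugraph" where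
  "graph_Union I C = \<lparr>verts = (\<Union>i\<in>I. verts (C i)), edges = (\<Union>i\<in>I. edges (C i))\<rparr>"

text \<open>Paths have at least one edge, so a single common edge is the shortest common path.\<close>

definition is_path :: "'a ugraph \<Rightarrow> bool" where
  "is_path P \<longleftrightarrow> (\<exists>vs. 2 \<le> length vs \<and> distinct vs \<and>
     P = \<lparr>verts = set vs,
          edges = {{vs ! i, vs ! Suc i} | i. Suc i < length vs}\<rparr>)"

definition is_cycle :: "'a ugraph \<Rightarrow> bool" where
  "is_cycle C \<longleftrightarrow> (\<exists>vs. 3 \<le> length vs \<and> distinct vs \<and>
     C = \<lparr>verts = set vs,
          edges = {{vs ! i, vs ! (Suc i mod length vs)} | i. i < length vs}\<rparr>)"

definition odd_cycle :: "'a ugraph \<Rightarrow> bool" where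
  "odd_cycle C \<longleftrightarrow> is_cycle C \<and> odd (card (edges C))"

definition even_cycle :: "'a ugraph \<Rightarrow> bool" where
  "even_cycle C \<longleftrightarrow> is_cycle C \<and> even (card (edges C))"

text \<open>
  The path \<open>P\<close> is everything that any two of the cycles share: if they could also meet elsewhere,
  the complete graph on four vertices would be a union of two 4-cycles through a common edge.
\<close>

definition conjoined_by :: "nat \<Rightarrow> (nat \<Rightarrow> 'a ugraph) \<Rightarrow> 'a ugraph \<Rightarrow> 'a ugraph \<Rightarrow> bool" where
  "conjoined_by n C P G \<longleftrightarrow>
     1 \<le> n \<and> is_path P \<and>
     (\<forall>i\<in>{1..n}. is_cycle (C i) \<and> subgraph P (C i)) \<and>
     (\<forall>i\<in>{1..n}. \<forall>j\<in>{1..n}. i \<noteq> j \<longrightarrow> graph_inter (C i) (C j) = P) \<and>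
     G = graph_Union {1..n} C"

definition odd_conjoined :: "'a ugraph \<Rightarrow> bool" where
  "odd_conjoined G \<longleftrightarrow> (\<exists>n C P. conjoined_by n C P G \<and> (\<forall>i\<in>{1..n}. odd_cycle (C i)))"

definition even_conjoined :: "'a ugraph \<Rightarrow> bool" where
  "even_conjoined G \<longleftrightarrow> (\<exists>n C P. conjoined_by n C P G \<and> (\<forall>i\<in>{1..n}. even_cycle (C i)))"

text \<open>
  Edges are two-element sets of vertices, and \<open>+\<close> on sets is the sumset, so the label of an edge
  is the sumset of the labels of its two ends.
\<close>

definition edge_label :: "('a \<Rightarrow> nat set) \<Rightarrow> 'a set \<Rightarrow> nat set" where
  "edge_label f e = (\<Sum>v\<in>e. f v)"

lemma edge_label_pair: "u \<noteq> v \<Longrightarrow> edge_label f {u, v} = {a + b | a b. a \<in> f u \<and> b \<in> f v}"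
  by (auto simp: edge_label_def set_plus_def)

text \<open>
  Set-labels are finite. With infinite labels every sumset with a nonempty set would attain the
  maximum cardinality, and no graph would need a mono-indexed edge.
\<close>

definition iasi :: "'a ugraph \<Rightarrow> ('a \<Rightarrow> nat set) \<Rightarrow> bool" where
  "iasi G f \<longleftrightarrow>
     (\<forall>v\<in>verts G. finite (f v)) \<and> inj_on f (verts G) \<and> inj_on (edge_label f) (edges G)"

definition weak_iasi :: "'a ugraph \<Rightarrow> ('a \<Rightarrow> nat set) \<Rightarrow> bool" where
  "weak_iasi G f \<longleftrightarrow> iasi G f \<and>
     (\<forall>u v. {u, v} \<in> edges G \<longrightarrow> card (edge_label f {u, v}) = max (card (f u)) (card (f v)))"

definition mono_indexed_edges :: "'a ugraph \<Rightarrow> ('a \<Rightarrow> nat set) \<Rightarrow> 'a set set" where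
  "mono_indexed_edges G f = {e \<in> edges G. card (edge_label f e) = 1}"

definition sparing_number :: "'a ugraph \<Rightarrow> nat" where
  "sparing_number G = (LEAST k. \<exists>f. weak_iasi G f \<and> card (mono_indexed_edges G f) = k)"

end

theory Submission
  imports Defs "HOL-Library.Nat_Bijection"
begin

text \<open>
  In a weak IASI one end of every edge has a singleton label, because \<open>card (A + B) > card A\<close>
  as soon as \<open>B\<close> has two elements. If no edge is mono-indexed, singleton and non-singleton labels
  therefore alternate along every cycle, which is impossible for an odd one.
  Conversely, choose an edge \<open>e\<close> of the common path and 2-colour every cycle so that the colours
  alternate off \<open>e\<close>, starting with a fixed colour at one end of \<open>e\<close>. The colours at both ends of
  \<open>e\<close> depend only on the parity of the cycle, so the colourings agree on the common path and glue
  to a colouring of the graph. It is realised by labels \<open>{x}\<close> and \<open>{x, x + 1}\<close>, where \<open>x\<close> ranges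
  over distinct powers of two, so that the minimum of an edge label determines the edge.
\<close>

section \<open>Growth of sumsets\<close>

text \<open>The translate of \<open>A\<close> by \<open>Min B\<close> already has
  \<open>card A\<close> elements, and \<open>Max A + Max B\<close> lies beyond all of them because
  \<open>Min B < Max B\<close>.\<close>

lemma card_sumset_gt:
  fixes A B :: "nat set"
  assumes "finite A" "A \<noteq> {}" "finite B" "2 \<le> card B"
  shows "card A < card (A + B)"
proof -
  have B: "B \<noteq> {}" using assms by auto
  have lt: "Min B < Max B"
  proof (rule ccontr)
    assume "\<not> Min B < Max B"
    hence "B \<subseteq> {Min B}"
      using assms(3) by (metis Max_ge Min_le insertCI le_antisym leI order_trans subsetI)
    hence "card B \<le> card {Min B}" by (intro card_mono) auto
    thus False using assms(4) by simp
  qed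
  let ?S = "(\<lambda>a. a + Min B) ` A"
  have "Max A + Max B \<notin> ?S"
  proof
    assume "Max A + Max B \<in> ?S"
    then obtain a where "a \<in> A" "Max A + Max B = a + Min B" by auto
    moreover have "a \<le> Max A" using \<open>a \<in> A\<close> assms(1) by simp
    ultimately show False using lt by linarith
  qed
  hence "card (insert (Max A + Max B) ?S) = Suc (card A)"
    using assms(1) by (simp add: card_image inj_on_def)
  moreover have "insert (Max A + Max B) ?S \<subseteq> A + B"
    using assms B by (auto intro!: set_plus_intro Max_in Min_in)
  moreover have "finite (A + B)" using assms by (simp add: finite_set_plus)
  ultimately show ?thesis by (metis Suc_le_eq card_mono)
qed

lemma edge_label_pair_plus: "u \<noteq> v \<Longrightarrow> edge_label f {u, v} = f u + f v"
  by (simp add: edge_label_def)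

section \<open>Cycles and their two-colourings\<close>

lemma cycle_edgeE:
  assumes "is_cycle C" "e \<in> edges C"
  obtains u v where "e = {u, v}" "u \<noteq> v" "u \<in> verts C" "v \<in> verts C"
proof -
  from assms(1) obtain vs where vs: "3 \<le> length vs" "distinct vs"
    "C = \<lparr>verts = set vs, edges = {{vs ! i, vs ! (Suc i mod length vs)} | i. i < length vs}\<rparr>"
    unfolding is_cycle_def by blast
  from assms(2) vs(3) obtain i where i: "i < length vs" "e = {vs ! i, vs ! (Suc i mod length vs)}"
    by auto
  have "Suc i mod length vs < length vs" "Suc i mod length vs \<noteq> i"
    using vs(1) i(1) by (auto simp: mod_Suc)
  with i vs that[of "vs ! i" "vs ! (Suc i mod length vs)"] show ?thesis
    by (simp add: nth_eq_iff_index_eq)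
qed

lemma finite_cycle:
  assumes "is_cycle C"
  shows "finite (verts C)" "finite (edges C)"
  using assms unfolding is_cycle_def by auto

text \<open>If edges \<open>i\<close> and \<open>j\<close> coincided for
  \<open>i \<noteq> j\<close>, each index would be the cyclic successor of the other, which needs
  length at most 2. This turns the parity of \<open>card (edges C)\<close> into that of the vertex
  list.\<close>

lemma card_cycle_edges:
  assumes "3 \<le> length vs" "distinct vs"
  shows "card {{vs ! i, vs ! (Suc i mod length vs)} | i. i < length vs} = length vs"
proof -
  let ?n = "length vs"
  let ?e = "\<lambda>i. {vs ! i, vs ! (Suc i mod ?n)}"
  have "inj_on ?e {..<?n}"
  proof (rule inj_onI)
    fix i j assume ij: "i \<in> {..<?n}" "j \<in> {..<?n}" "?e i = ?e j"
    have "0 < ?n" using assms(1) by linarith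
    hence lt: "Suc i mod ?n < ?n" "Suc j mod ?n < ?n" by (rule mod_less_divisor)+
    show "i = j"
    proof (rule ccontr)
      assume "i \<noteq> j"
      hence "vs ! i = vs ! (Suc j mod ?n)" "vs ! j = vs ! (Suc i mod ?n)"
        using ij assms(2) by (auto simp: doubleton_eq_iff nth_eq_iff_index_eq)
      hence "i = Suc j mod ?n" "j = Suc i mod ?n"
        using ij lt assms(2) by (auto simp: nth_eq_iff_index_eq)
      moreover have "Suc i mod ?n = (if Suc i = ?n then 0 else Suc i)"
        "Suc j mod ?n = (if Suc j = ?n then 0 else Suc j)" using ij(1,2) by auto
      ultimately have "i = 0 \<and> Suc j = ?n \<or> i = Suc j" "j = 0 \<and> Suc i = ?n \<or> j = Suc i"
        by metis+
      thus False using assms(1) by linarith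
    qed
  qed
  hence "card (?e ` {..<?n}) = ?n" by (simp add: card_image)
  moreover have "?e ` {..<?n} = {?e i | i. i < ?n}" by auto
  ultimately show ?thesis by simp
qed

text \<open>Under strict alternation the last vertex of an odd list would have the colour of the
  first, yet the closing edge joins the two.\<close>

lemma odd_cycle_not_2_colourable:
  assumes "odd_cycle C"
  shows "\<exists>u v. {u, v} \<in> edges C \<and> u \<noteq> v \<and> s u = (s v :: bool)"
proof (rule ccontr)
  assume *: "\<not> ?thesis"
  from assms obtain vs where vs: "3 \<le> length vs" "distinct vs"
    "C = \<lparr>verts = set vs, edges = {{vs ! i, vs ! (Suc i mod length vs)} | i. i < length vs}\<rparr>"
    unfolding is_cycle_def odd_cycle_def by blast
  have n: "odd (length vs)"
    using assms card_cycle_edges[OF vs(1,2)] unfolding odd_cycle_def vs(3) by simp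
  have alt: "s (vs ! i) \<noteq> s (vs ! (Suc i mod length vs))" if "i < length vs" for i
  proof -
    have "vs ! i \<noteq> vs ! (Suc i mod length vs)"
      using vs(1,2) that by (subst nth_eq_iff_index_eq) (auto simp: mod_Suc)
    moreover have "{vs ! i, vs ! (Suc i mod length vs)} \<in> edges C"
      using that vs(3) by auto
    ultimately show ?thesis using * by blast
  qed
  have walk: "k < length vs \<Longrightarrow> s (vs ! k) = (s (vs ! 0) = even k)" for k
  proof (induction k)
    case (Suc k)
    thus ?case using alt[of k] by auto
  qed simp
  obtain m where "length vs = Suc m" using vs(1) by (cases "length vs") auto
  thus False using walk[of m] alt[of m] n by auto
qed

text \<open>Without \<open>{a, b}\<close> the cycle is a path with one edge fewer. Alternating along
  it gives \<open>a\<close> and \<open>b\<close> different colours exactly when the cycle is even.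
  Fixing the colour of \<open>a\<close> makes colourings of different cycles comparable.\<close>

lemma cycle_colouring:
  assumes "is_cycle C" "{a, b} \<in> edges C"
  shows "\<exists>c. \<not> c a \<and> c b = even (card (edges C)) \<and>
    (\<forall>u v. {u, v} \<in> edges C \<longrightarrow> {u, v} \<noteq> {a, b} \<longrightarrow> c u \<noteq> c v)"
proof -
  from assms(1) obtain vs where vs: "3 \<le> length vs" "distinct vs"
    "C = \<lparr>verts = set vs, edges = {{vs ! i, vs ! (Suc i mod length vs)} | i. i < length vs}\<rparr>"
    unfolding is_cycle_def by blast
  let ?n = "length vs"
  from assms(2) vs(3) obtain j where j: "j < ?n" "{a, b} = {vs ! j, vs ! (Suc j mod ?n)}"
    by auto
  define pos where "pos = inv_into {..<?n} ((!) vs)"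
  have pos: "pos (vs ! k) = k" if "k < ?n" for k
    unfolding pos_def using that vs(2)
    by (intro inv_into_f_f) (auto simp: inj_on_def nth_eq_iff_index_eq)
  \<comment> \<open>Parity of the distance from \<open>vs ! Suc j\<close>, walking away from the edge \<open>{a, b}\<close>.\<close>
  define q where "q k = odd (if k > j then k - j - 1 else k + ?n - j - 1)" for k
  have alt: "q k \<noteq> q (Suc k mod ?n)" if "k < ?n" "k \<noteq> j" for k
  proof (cases "Suc k = ?n")
    case True
    hence "?n = Suc k" by simp
    thus ?thesis using that j(1) unfolding q_def by auto
  next
    case False
    thus ?thesis using that j(1) unfolding q_def by auto
  qed
  \<comment> \<open>The cyclic successor of \<open>j\<close> is at distance 0 and \<open>j\<close>
    itself at distance \<open>?n - 1\<close>.\<close>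
  have qj: "(q j \<noteq> q (Suc j mod ?n)) = even ?n"
  proof (cases "Suc j = ?n")
    case True
    hence "?n = Suc j" by simp
    thus ?thesis unfolding q_def by auto
  next
    case False
    thus ?thesis using j(1) unfolding q_def by auto
  qed
  \<comment> \<open>Comparing with the value at \<open>a\<close> makes \<open>c a\<close> false
    whichever way \<open>{a, b}\<close> is oriented in \<open>vs\<close>.\<close>
  define c where "c v = (q (pos v) \<noteq> q (pos a))" for v
  have lt: "Suc k mod ?n < ?n" for k using j(1) by (intro mod_less_divisor) linarith
  have "(q (pos b) \<noteq> q (pos a)) = even ?n"
    using j(2) qj pos[OF j(1)] pos[OF lt[of j]] by (auto simp: doubleton_eq_iff)
  moreover have "c u \<noteq> c v" if uv: "{u, v} \<in> edges C" "{u, v} \<noteq> {a, b}" for u v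
  proof -
    from uv(1) vs(3) obtain k where k: "k < ?n" "{u, v} = {vs ! k, vs ! (Suc k mod ?n)}" by auto
    with uv(2) j(2) have "k \<noteq> j" by auto
    with alt[OF k(1)] k(2) pos[OF k(1)] pos[OF lt[of k]] show ?thesis
      by (auto simp: c_def doubleton_eq_iff)
  qed
  moreover have "card (edges C) = ?n" using card_cycle_edges[OF vs(1,2)] vs(3) by simp
  ultimately show ?thesis by (intro exI[of _ c]) (auto simp: c_def)
qed

section \<open>Gluing colourings along the common path\<close>

text \<open>The parameter \<open>p\<close> serves both parities: with \<open>p\<close> true the
  colouring is proper, with \<open>p\<close> false \<open>{a, b}\<close> is its only defect and both
  its ends are uncoloured.\<close>

lemma conjoined_colouring:
  assumes G: "conjoined_by n C P G"
    and parity: "\<And>i. i \<in> {1..n} \<Longrightarrow> even (card (edges (C i))) = p"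
  shows "\<exists>a b c. {a, b} \<in> edges G \<and> a \<noteq> b \<and> \<not> c a \<and> c b = p \<and>
    (\<forall>u v. {u, v} \<in> edges G \<longrightarrow> {u, v} \<noteq> {a, b} \<longrightarrow> c u \<noteq> c v)"
proof -
  from G obtain vs where vs: "2 \<le> length vs" "distinct vs"
    "P = \<lparr>verts = set vs, edges = {{vs ! i, vs ! Suc i} | i. Suc i < length vs}\<rparr>"
    unfolding conjoined_by_def is_path_def by blast
  \<comment> \<open>Taking the first edge of the path leaves the rest of it on one side, so a single
    induction starting from \<open>b\<close> covers it.\<close>
  define a b where "a = vs ! 0" and "b = vs ! 1"
  have abP: "{a, b} \<in> edges P" using vs(1,3) by (auto simp: a_def b_def intro!: exI[of _ 0])
  have cyc: "is_cycle (C i)" and sub: "edges P \<subseteq> edges (C i)" "verts P \<subseteq> verts (C i)"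
    if "i \<in> {1..n}" for i
    using G that unfolding conjoined_by_def subgraph_def by auto
  have "\<exists>c. \<not> c a \<and> c b = p \<and>
      (\<forall>u v. {u, v} \<in> edges (C i) \<longrightarrow> {u, v} \<noteq> {a, b} \<longrightarrow> c u \<noteq> c v)"
    if "i \<in> {1..n}" for i
  proof -
    have "{a, b} \<in> edges (C i)" using sub(1)[OF that] abP by blast
    from cycle_colouring[OF cyc[OF that] this] parity[OF that] show ?thesis by simp
  qed
  then obtain c where c: "\<And>i. i \<in> {1..n} \<Longrightarrow> \<not> c i a" "\<And>i. i \<in> {1..n} \<Longrightarrow> c i b = p"
    "\<And>i u v. i \<in> {1..n} \<Longrightarrow> {u, v} \<in> edges (C i) \<Longrightarrow> {u, v} \<noteq> {a, b} \<Longrightarrow> c i u \<noteq> c i v"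
    by metis
  \<comment> \<open>The induction starts at index 1, since the edge from index 0 is the exempt one.
    Later path edges avoid \<open>a\<close>, so both colourings flip along each of them.\<close>
  have on_path: "c i (vs ! Suc k) = c j (vs ! Suc k)"
    if ij: "i \<in> {1..n}" "j \<in> {1..n}" and "Suc k < length vs" for i j k
    using that(3)
  proof (induction k)
    case 0
    thus ?case using c(2) ij by (simp add: b_def)
  next
    case (Suc k)
    have "{vs ! Suc k, vs ! Suc (Suc k)} \<in> edges P" using Suc.prems vs(3) by auto
    hence e: "{vs ! Suc k, vs ! Suc (Suc k)} \<in> edges (C i)"
      "{vs ! Suc k, vs ! Suc (Suc k)} \<in> edges (C j)" using sub(1) ij by blast+
    have "a \<noteq> vs ! Suc k" "a \<noteq> vs ! Suc (Suc k)"
      using Suc.prems vs(2) unfolding a_def by (subst nth_eq_iff_index_eq; auto)+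
    hence "{vs ! Suc k, vs ! Suc (Suc k)} \<noteq> {a, b}" by auto
    with c(3)[OF ij(1) e(1)] c(3)[OF ij(2) e(2)] Suc show ?case by simp
  qed
  \<comment> \<open>Distinct cycles meet only in \<open>P\<close>, so agreement on the path
    suffices.\<close>
  have agree: "c i v = c j v"
    if ij: "i \<in> {1..n}" "j \<in> {1..n}" and v: "v \<in> verts (C i)" "v \<in> verts (C j)" for i j v
  proof (cases "i = j")
    case False
    hence "graph_inter (C i) (C j) = P" using G ij unfolding conjoined_by_def by blast
    hence "v \<in> set vs" using v vs(3) by (auto simp: graph_inter_def)
    then obtain k where k: "k < length vs" "v = vs ! k" by (auto simp: in_set_conv_nth)
    show ?thesis
    proof (cases k)
      case 0
      thus ?thesis using k c(1) ij by (simp add: a_def)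
    next
      case (Suc m)
      thus ?thesis using on_path[OF ij] k by simp
    qed
  qed simp
  \<comment> \<open>By \<open>agree\<close> the chosen cycle does not matter; values outside the
    graph are arbitrary.\<close>
  define d where "d v = c (SOME i. i \<in> {1..n} \<and> v \<in> verts (C i)) v" for v
  have d: "d v = c i v" if "i \<in> {1..n}" "v \<in> verts (C i)" for i v
  proof -
    have "(SOME i. i \<in> {1..n} \<and> v \<in> verts (C i)) \<in> {1..n} \<and>
        v \<in> verts (C (SOME i. i \<in> {1..n} \<and> v \<in> verts (C i)))"
      by (rule someI[of _ i]) (use that in blast)
    thus ?thesis unfolding d_def using agree that by blast
  qed
  have one: "1 \<in> {1..n}" using G unfolding conjoined_by_def by auto
  have edgesG: "edges G = (\<Union>i\<in>{1..n}. edges (C i))"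
    using G unfolding conjoined_by_def graph_Union_def by simp
  have ab: "a \<in> verts (C 1)" "b \<in> verts (C 1)" "a \<noteq> b"
  proof -
    have len: "0 < length vs" "1 < length vs" using vs(1) by linarith+
    have "set vs \<subseteq> verts (C 1)" using sub(2)[OF one] vs(3) by simp
    thus "a \<in> verts (C 1)" "b \<in> verts (C 1)" using len unfolding a_def b_def by auto
    show "a \<noteq> b" using len vs(2) unfolding a_def b_def by (simp add: nth_eq_iff_index_eq)
  qed
  have "d u \<noteq> d v" if uv: "{u, v} \<in> edges G" "{u, v} \<noteq> {a, b}" for u v
  proof -
    from uv(1) edgesG obtain i where i: "i \<in> {1..n}" "{u, v} \<in> edges (C i)" by auto
    from cycle_edgeE[OF cyc[OF i(1)] i(2)] have "u \<in> verts (C i)" "v \<in> verts (C i)"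
      by (metis doubleton_eq_iff)+
    thus ?thesis using d i c(3)[OF i uv(2)] by simp
  qed
  moreover have "{a, b} \<in> edges G" using edgesG one sub(1)[OF one] abP by blast
  moreover have "\<not> d a" "d b = p" using d[OF one] ab c(1,2)[OF one] by auto
  ultimately show ?thesis using ab(3) by blast
qed

section \<open>From colourings to weak IASIs\<close>

text \<open>Coloured vertices receive the two-element labels. They must be pairwise nonadjacent,
  since two blocks of consecutive integers of length 2 sum to one of length 3.\<close>

lemma weak_iasi_of_colouring:
  fixes G :: "'a ugraph"
  assumes fin: "finite (verts G)"
    and E: "\<And>e. e \<in> edges G \<Longrightarrow> \<exists>u v. e = {u, v} \<and> u \<noteq> v \<and> u \<in> verts G \<and> v \<in> verts G"
    and c: "\<And>u v. {u, v} \<in> edges G \<Longrightarrow> \<not> (c u \<and> c v)"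
  shows "\<exists>f. weak_iasi G f \<and> mono_indexed_edges G f = {e \<in> edges G. \<forall>v\<in>e. \<not> c v}"
proof -
  from fin obtain h :: "'a \<Rightarrow> nat" where h: "inj_on h (verts G)"
    using finite_imp_inj_to_nat_seg by blast
  define f where "f v = (if c v then {2 ^ h v, 2 ^ h v + 1} else {2 ^ h v :: nat})" for v
  have Min_f: "Min (f v) = 2 ^ h v" for v by (simp add: f_def min_def)
  have card_f: "card (f v) = (if c v then 2 else 1)" for v by (simp add: f_def)
  have lab: "edge_label f {u, v} = (if c u \<or> c v then {2 ^ h u + 2 ^ h v, 2 ^ h u + 2 ^ h v + 1}
      else {2 ^ h u + 2 ^ h v})" if "{u, v} \<in> edges G" "u \<noteq> v" for u v
    using c[OF that(1)] that(2) by (auto simp: edge_label_pair f_def)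
  \<comment> \<open>\<open>set_encode\<close> sums the powers of two indexed by a set, and it is
    injective on finite sets by uniqueness of binary expansions.\<close>
  have Min_lab: "Min (edge_label f e) = set_encode (h ` e)" if e: "e \<in> edges G" for e
  proof -
    from E[OF e] obtain u v where uv: "e = {u, v}" "u \<noteq> v" "u \<in> verts G" "v \<in> verts G" by blast
    hence "h u \<noteq> h v" using h by (auto dest: inj_onD)
    moreover have "Min (edge_label f {u, v}) = 2 ^ h u + 2 ^ h v"
      using lab uv e by (simp add: min_def)
    ultimately show ?thesis using uv(1) by (simp add: set_encode_def)
  qed
  have "inj_on f (verts G)"
  proof (rule inj_onI)
    fix u v assume uv: "u \<in> verts G" "v \<in> verts G" "f u = f v"
    hence "(2::nat) ^ h u = 2 ^ h v" using Min_f by metis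
    thus "u = v" using h uv by (auto dest: inj_onD)
  qed
  moreover have "inj_on (edge_label f) (edges G)"
  proof (rule inj_onI)
    fix e e' assume ee: "e \<in> edges G" "e' \<in> edges G" "edge_label f e = edge_label f e'"
    have sub: "e \<subseteq> verts G" "e' \<subseteq> verts G" using E ee(1,2) by blast+
    hence "finite (h ` e)" "finite (h ` e')" using fin finite_subset by blast+
    moreover have "set_encode (h ` e) = set_encode (h ` e')" using Min_lab ee by metis
    ultimately have "h ` e = h ` e'" by (metis set_encode_eq)
    thus "e = e'" using inj_on_image_eq_iff[OF h] sub by blast
  qed
  moreover have "card (edge_label f {u, v}) = max (card (f u)) (card (f v))"
    if "{u, v} \<in> edges G" for u v
  proof -
    have "u \<noteq> v" using E[OF that] by auto
    thus ?thesis using lab[OF that] c[OF that] by (auto simp: card_f)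
  qed
  moreover have "finite (f v)" for v by (simp add: f_def)
  ultimately have "weak_iasi G f" unfolding weak_iasi_def iasi_def by blast
  moreover have "card (edge_label f e) = 1 \<longleftrightarrow> (\<forall>v\<in>e. \<not> c v)" if e: "e \<in> edges G" for e
  proof -
    from E[OF e] obtain u v where "e = {u, v}" "u \<noteq> v" by blast
    thus ?thesis using lab[of u v] e by auto
  qed
  hence "mono_indexed_edges G f = {e \<in> edges G. \<forall>v\<in>e. \<not> c v}"
    unfolding mono_indexed_edges_def by blast
  ultimately show ?thesis by blast
qed

section \<open>The lower bound from an odd cycle\<close>

text \<open>Colour vertices by whether their label is a singleton. Some edge has ends of equal
  colour; two non-singletons would make the sumset too large, so both ends are singletons.\<close>

lemma weak_iasi_odd_cycle_mono_indexed:
  assumes f: "weak_iasi G f" and C: "odd_cycle C" "subgraph C G"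
  shows "mono_indexed_edges G f \<noteq> {}"
proof -
  obtain u v where uv: "{u, v} \<in> edges C" "u \<noteq> v" "(card (f u) = 1) = (card (f v) = 1)"
    using odd_cycle_not_2_colourable[OF C(1), of "\<lambda>v. card (f v) = 1"] by blast
  have cyc: "is_cycle C" using C(1) unfolding odd_cycle_def by simp
  have "u \<in> verts C" "v \<in> verts C"
    using cycle_edgeE[OF cyc uv(1)] by (metis doubleton_eq_iff)+
  hence V: "u \<in> verts G" "v \<in> verts G" and e: "{u, v} \<in> edges G"
    using C(2) uv(1) unfolding subgraph_def by auto
  have fin: "finite (f u)" "finite (f v)" and ne: "f u \<noteq> f v"
    using f V uv(2) unfolding weak_iasi_def iasi_def by (auto dest: inj_onD)
  have card: "card (f u + f v) = max (card (f u)) (card (f v))"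
    using f e edge_label_pair_plus[OF uv(2), of f] unfolding weak_iasi_def by metis
  \<comment> \<open>One empty label would empty the sumset, hence force the maximum to be 0 and both
    labels to be empty, against injectivity.\<close>
  have ne': "f u \<noteq> {}" "f v \<noteq> {}"
    using card fin ne by (auto simp: set_plus_def max_def split: if_splits)
  hence pos: "card (f u) \<ge> 1" "card (f v) \<ge> 1" using fin by (auto simp: Suc_le_eq card_gt_0_iff)
  have "card (f u) = 1 \<and> card (f v) = 1"
  proof (rule ccontr)
    assume "\<not> ?thesis"
    hence "2 \<le> card (f u)" "2 \<le> card (f v)" using uv(3) pos by auto
    hence "card (f u) < card (f u + f v)" "card (f v) < card (f u + f v)"
      using card_sumset_gt[of "f u" "f v"] card_sumset_gt[of "f v" "f u"] fin ne'
      by (auto simp: add.commute)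
    thus False using card by simp
  qed
  hence "{u, v} \<in> mono_indexed_edges G f"
    using card e edge_label_pair_plus[OF uv(2), of f] unfolding mono_indexed_edges_def by simp
  thus ?thesis by blast
qed

section \<open>The sparing numbers\<close>

lemma conjoined_by_wellformed:
  assumes "conjoined_by n C P G"
  shows "finite (verts G)" "finite (edges G)"
    and "e \<in> edges G \<Longrightarrow> \<exists>u v. e = {u, v} \<and> u \<noteq> v \<and> u \<in> verts G \<and> v \<in> verts G"
proof -
  have G: "verts G = (\<Union>i\<in>{1..n}. verts (C i))" "edges G = (\<Union>i\<in>{1..n}. edges (C i))"
    using assms unfolding conjoined_by_def graph_Union_def by simp_all
  have cyc: "is_cycle (C i)" if "i \<in> {1..n}" for i
    using assms that unfolding conjoined_by_def by blast
  show "finite (verts G)" "finite (edges G)" unfolding G by (auto intro!: finite_cycle cyc)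
  assume "e \<in> edges G"
  then obtain i where i: "i \<in> {1..n}" "e \<in> edges (C i)" using G by auto
  from cycle_edgeE[OF cyc[OF i(1)] i(2)]
  show "\<exists>u v. e = {u, v} \<and> u \<noteq> v \<and> u \<in> verts G \<and> v \<in> verts G" using G i(1) by (metis UN_I)
qed

lemma sparing_number_odd_conjoined:
  assumes "odd_conjoined G"
  shows "sparing_number G = 1"
proof -
  from assms obtain n C P where G: "conjoined_by n C P G"
    and odd: "\<And>i. i \<in> {1..n} \<Longrightarrow> odd_cycle (C i)" unfolding odd_conjoined_def by blast
  have "even (card (edges (C i))) = False" if "i \<in> {1..n}" for i
    using odd[OF that] unfolding odd_cycle_def by simp
  from conjoined_colouring[OF G this] obtain a b c where c: "{a, b} \<in> edges G" "\<not> c a" "\<not> c b"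
    "\<And>u v. {u, v} \<in> edges G \<Longrightarrow> {u, v} \<noteq> {a, b} \<Longrightarrow> c u \<noteq> c v" by blast
  note wf = conjoined_by_wellformed[OF G]
  \<comment> \<open>The edge \<open>{a, b}\<close> has no coloured end, every other edge exactly
    one.\<close>
  have nc: "\<not> (c u \<and> c v)" if "{u, v} \<in> edges G" for u v
    using c(2,3) c(4)[OF that] by (auto simp: doubleton_eq_iff)
  have "\<exists>f. weak_iasi G f \<and> mono_indexed_edges G f = {e \<in> edges G. \<forall>v\<in>e. \<not> c v}"
    by (rule weak_iasi_of_colouring) (fact wf(1), fact wf(3), fact nc)
  then obtain f
    where f: "weak_iasi G f" "mono_indexed_edges G f = {e \<in> edges G. \<forall>v\<in>e. \<not> c v}" by blast
  have "e = {a, b}" if e: "e \<in> edges G" "\<forall>v\<in>e. \<not> c v" for e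
    using wf(3)[OF e(1)] e c(4) by (metis insertCI)
  hence "mono_indexed_edges G f = {{a, b}}" unfolding f(2) using c(1-3) by blast
  hence "\<exists>f. weak_iasi G f \<and> card (mono_indexed_edges G f) = 1" using f(1) by auto
  \<comment> \<open>A single odd cycle such as \<open>C 1\<close> suffices; finiteness of the edge
    set turns nonempty into positive cardinality.\<close>
  moreover have "1 \<le> k" if "\<exists>f. weak_iasi G f \<and> card (mono_indexed_edges G f) = k" for k
  proof -
    from that obtain f where f: "weak_iasi G f" "card (mono_indexed_edges G f) = k" by blast
    have one: "1 \<in> {1..n}" using G unfolding conjoined_by_def by auto
    hence "subgraph (C 1) G"
      using G unfolding conjoined_by_def subgraph_def graph_Union_def by auto
    hence "mono_indexed_edges G f \<noteq> {}"
      using weak_iasi_odd_cycle_mono_indexed[OF f(1) odd[OF one]] by blast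
    moreover have "finite (mono_indexed_edges G f)"
      using wf(2) unfolding mono_indexed_edges_def by simp
    ultimately show ?thesis using f(2) by (auto simp: Suc_le_eq card_gt_0_iff)
  qed
  ultimately show ?thesis unfolding sparing_number_def by (rule Least_equality)
qed

lemma sparing_number_even_conjoined:
  assumes "even_conjoined G"
  shows "sparing_number G = 0"
proof -
  from assms obtain n C P where G: "conjoined_by n C P G"
    and even: "\<And>i. i \<in> {1..n} \<Longrightarrow> even_cycle (C i)" unfolding even_conjoined_def by blast
  have "even (card (edges (C i))) = True" if "i \<in> {1..n}" for i
    using even[OF that] unfolding even_cycle_def by simp
  from conjoined_colouring[OF G this] obtain a b c where c: "\<not> c a" "c b"
    "\<And>u v. {u, v} \<in> edges G \<Longrightarrow> {u, v} \<noteq> {a, b} \<Longrightarrow> c u \<noteq> c v" by blast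
  note wf = conjoined_by_wellformed[OF G]
  \<comment> \<open>Here \<open>a\<close> and \<open>b\<close> differ as well, so even the exempt
    edge is properly coloured.\<close>
  have alt: "c u \<noteq> c v" if "{u, v} \<in> edges G" "u \<noteq> v" for u v
    using c(1,2) c(3)[OF that(1)] that(2) by (auto simp: doubleton_eq_iff)
  have nc: "\<not> (c u \<and> c v)" if "{u, v} \<in> edges G" for u v
    using alt[OF that] wf(3)[OF that] by (auto simp: doubleton_eq_iff)
  have "\<exists>f. weak_iasi G f \<and> mono_indexed_edges G f = {e \<in> edges G. \<forall>v\<in>e. \<not> c v}"
    by (rule weak_iasi_of_colouring) (fact wf(1), fact wf(3), fact nc)
  then obtain f
    where f: "weak_iasi G f" "mono_indexed_edges G f = {e \<in> edges G. \<forall>v\<in>e. \<not> c v}" by blast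
  have "\<not> (\<forall>v\<in>e. \<not> c v)" if e: "e \<in> edges G" for e
    using wf(3)[OF e] e alt by (metis insertCI)
  hence "mono_indexed_edges G f = {}" using f(2) by auto
  hence "\<exists>f. weak_iasi G f \<and> card (mono_indexed_edges G f) = 0" using f(1) by auto
  thus ?thesis unfolding sparing_number_def by (rule Least_eq_0)
qed

theorem theorem3p2:
  fixes G :: "'a ugraph"
  shows "(odd_conjoined G \<longrightarrow> sparing_number G = 1) \<and>
         (even_conjoined G \<longrightarrow> sparing_number G = 0)"
  using sparing_number_odd_conjoined sparing_number_even_conjoined by blast

end
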